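(* Let $\mathbb{F}$ be any field and let $R$ be a regular subgroup of $\mathrm{AGL}_n(\mathbb{F})$. Set $$V=R-I_{n+1}=\left\{\begin{pmatrix}0&v\\0&\delta_R(v)\end{pmatrix}: v\in\mathbb{F}^n\right\}\quad\text{and}\quad \mathcal{L}_R=\mathbb{F}I_{n+1}+V.$$ (a) If $\delta_R$ is additive, then $V$ is a subring (without identity) of $\mathrm{Mat}_{n+1}(\mathbb{F})$. (b) The function $\delta_R$ is linear if and only if $\mathcal{L}_R$ is a split local subalgebra of $\mathrm{Mat}_{n+1}(\mathbb{F})$ with Jacobson radical $\mathbf{J}(\mathcal{L}_R)=V$.
   Context: $\mathrm{AGL}_n(\mathbb{F})$ is the subgroup of $\mathrm{GL}_{n+1}(\mathbb{F})$ consisting of the matrices with first column $(1,0,\dots,0)^{\mathrm T}$. A subgroup $R\le\mathrm{AGL}_n(\mathbb{F})$ is regular if for every $v\in\mathbb{F}^n$ there is exactly one element of $R$ with first row $(1,v)$; this element is written $\mu_R(v)=\begin{pmatrix}1&v\\0&I_n+\delta_R(v)\end{pmatrix}$, defining $\delta_R:\mathbb{F}^n\to\mathrm{Mat}_n(\mathbb{F})$; "linear" means $\mathbb{F}$-linear and "additive" means $\delta_R(v+w)=\delta_R(v)+\delta_R(w)$. An $\mathbb{F}$-algebra $\mathcal{L}$ with $1$ is split local if $\mathcal{L}/\mathbf{J}(\mathcal{L})\cong\mathbb{F}$, where $\mathbf{J}(\mathcal{L})$ is its Jacobson radical. *)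

theory Defs
  imports "Jordan_Normal_Form.VS_Connect" "HOL-Algebra.QuotRing" "HOL-Algebra.Subrings"
begin

section \<open>Algebras over a field and the Jacobson radical\<close>

text \<open>The locale \<open>algebra\<close> of HOL-Algebra only covers commutative algebras.\<close>

definition assoc_algebra :: "('k, 'c) ring_scheme \<Rightarrow> ('k, 'a, 'd) module_scheme \<Rightarrow> bool" where
  "assoc_algebra K A \<longleftrightarrow> Module.module K A \<and> ring A \<and>
     (\<forall>a \<in> carrier K. \<forall>x \<in> carrier A. \<forall>y \<in> carrier A.
        (a \<odot>\<^bsub>A\<^esub> x) \<otimes>\<^bsub>A\<^esub> y = a \<odot>\<^bsub>A\<^esub> (x \<otimes>\<^bsub>A\<^esub> y) \<and>
        x \<otimes>\<^bsub>A\<^esub> (a \<odot>\<^bsub>A\<^esub> y) = a \<odot>\<^bsub>A\<^esub> (x \<otimes>\<^bsub>A\<^esub> y))"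

definition unital_subalgebra ::
  "('k, 'c) ring_scheme \<Rightarrow> 'a set \<Rightarrow> ('k, 'a, 'd) module_scheme \<Rightarrow> bool" where
  "unital_subalgebra K B A \<longleftrightarrow> subring B A \<and> (\<forall>a \<in> carrier K. \<forall>x \<in> B. a \<odot>\<^bsub>A\<^esub> x \<in> B)"

text \<open>Subrings that need not contain the identity (\<open>subring\<close> requires it).\<close>

definition nonunital_subring :: "'a set \<Rightarrow> ('a, 'b) ring_scheme \<Rightarrow> bool" where
  "nonunital_subring B A \<longleftrightarrow> additive_subgroup B A \<and> (\<forall>x \<in> B. \<forall>y \<in> B. x \<otimes>\<^bsub>A\<^esub> y \<in> B)"

definition left_ideal :: "'a set \<Rightarrow> ('a, 'b) ring_scheme \<Rightarrow> bool" where
  "left_ideal I A \<longleftrightarrow> additive_subgroup I A \<and> (\<forall>x \<in> carrier A. \<forall>y \<in> I. x \<otimes>\<^bsub>A\<^esub> y \<in> I)"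

definition maximal_left_ideal :: "'a set \<Rightarrow> ('a, 'b) ring_scheme \<Rightarrow> bool" where
  "maximal_left_ideal I A \<longleftrightarrow> left_ideal I A \<and> I \<noteq> carrier A \<and>
     (\<forall>J. left_ideal J A \<longrightarrow> I \<subseteq> J \<longrightarrow> J = I \<or> J = carrier A)"

definition jacobson_radical :: "('a, 'b) ring_scheme \<Rightarrow> 'a set" where
  "jacobson_radical A = {x \<in> carrier A. \<forall>I. maximal_left_ideal I A \<longrightarrow> x \<in> I}"

text \<open>\<open>A / J(A)\<close> is isomorphic to \<open>K\<close> as a \<open>K\<close>-algebra: the equation below says that the ring
  isomorphism \<open>f\<close> is linear for the scalar action \<open>a \<odot> (J(A) + x) = J(A) + a \<odot> x\<close>, which the
  quotient ring of HOL-Algebra does not carry.\<close>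

definition split_local :: "('k, 'c) ring_scheme \<Rightarrow> ('k, 'a, 'd) module_scheme \<Rightarrow> bool" where
  "split_local K A \<longleftrightarrow> assoc_algebra K A \<and>
     (\<exists>f \<in> ring_iso (A Quot jacobson_radical A) K. \<forall>a \<in> carrier K. \<forall>x \<in> carrier A.
        f (jacobson_radical A +>\<^bsub>A\<^esub> (a \<odot>\<^bsub>A\<^esub> x)) = a \<otimes>\<^bsub>K\<^esub> f (jacobson_radical A +>\<^bsub>A\<^esub> x))"


section \<open>The affine group and its regular subgroups\<close>

abbreviation mat_algebra :: "nat \<Rightarrow> ('a :: field, 'a mat) module" where
  "mat_algebra m \<equiv> module_mat TYPE('a) m m"

definition GL :: "nat \<Rightarrow> 'a :: field mat monoid" where
  "GL m = units_of (mat_algebra m)"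

definition AGL :: "nat \<Rightarrow> 'a :: field mat monoid" where
  "AGL n = (GL (n + 1))\<lparr>carrier := {A \<in> carrier (GL (n + 1)). col A 0 = unit_vec (n + 1) 0}\<rparr>"

definition regular_subgroup :: "nat \<Rightarrow> 'a :: field mat set \<Rightarrow> bool" where
  "regular_subgroup n R \<longleftrightarrow> subgroup R (AGL n) \<and>
     (\<forall>v \<in> carrier_vec n. \<exists>!A. A \<in> R \<and> row A 0 = vCons 1 v)"

definition mu :: "'a :: field mat set \<Rightarrow> 'a vec \<Rightarrow> 'a mat" where
  "mu R v = (THE A. A \<in> R \<and> row A 0 = vCons 1 v)"

text \<open>Deleting the row and column with index 0 of \<open>mu R v\<close> leaves the block \<open>I + delta R v\<close>.\<close>

definition delta :: "'a :: field mat set \<Rightarrow> 'a vec \<Rightarrow> 'a mat" where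
  "delta R v = mat_delete (mu R v) 0 0 - 1\<^sub>m (dim_vec v)"

end

theory Submission
  imports Defs
begin

text \<open>An element of $V$ is determined by its first row, so additivity (linearity) of $\delta_R$
  says that $V$ is closed under addition (and scalars), and then $V$ is also closed under
  multiplication. If $V$ is a subspace, every element $a + x$ of $L \setminus V$ with $x \in V$,
  $a \neq 0$ is a unit of $L$, because $1 + a^{-1} x$ lies in the group $R \subseteq L$; hence $V$
  is the unique maximal left ideal, and reading off the entry $(0, 0)$ identifies $L / V$ with the
  field. Conversely, a Jacobson radical is a left ideal, and $L$ contains the scalar matrices.\<close>

section \<open>Jacobson radicals in general rings\<close>

text \<open>An intersection of left ideals is again one; if there is no maximal left ideal, the
  intersection is the whole carrier. The converse half of (b) draws the closure properties of
  \<open>V\<close> from this.\<close>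

lemma (in ring) left_ideal_jacobson_radical: "left_ideal (jacobson_radical R) R"
proof -
  have add: "subgroup I (add_monoid R)" if "maximal_left_ideal I R" for I
    using that by (simp add: maximal_left_ideal_def left_ideal_def additive_subgroup_def)
  have mul: "x \<otimes> y \<in> I" if "maximal_left_ideal I R" "x \<in> carrier R" "y \<in> I" for I x y
    using that by (simp add: maximal_left_ideal_def left_ideal_def)
  have "subgroup (jacobson_radical R) (add_monoid R)"
  proof (rule add.subgroupI)
    show "jacobson_radical R \<subseteq> carrier R"
      by (auto simp: jacobson_radical_def)
    have "\<zero> \<in> jacobson_radical R"
      using subgroup.one_closed[OF add] by (simp add: jacobson_radical_def)
    then show "jacobson_radical R \<noteq> {}" by blast
    show "\<ominus> x \<in> jacobson_radical R" if "x \<in> jacobson_radical R" for x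
      using that subgroup.m_inv_closed[OF add]
      by (simp add: jacobson_radical_def a_inv_def)
    show "x \<oplus> y \<in> jacobson_radical R"
      if "x \<in> jacobson_radical R" "y \<in> jacobson_radical R" for x y
      using that subgroup.m_closed[OF add] by (simp add: jacobson_radical_def)
  qed
  then show ?thesis
    using mul by (simp add: left_ideal_def jacobson_radical_def additive_subgroup_def)
qed

lemma left_ideal_subset: "left_ideal I A \<Longrightarrow> I \<subseteq> carrier A"
  by (simp add: left_ideal_def additive_subgroup.a_subset)

lemma (in ring) left_ideal_eq_carrierI:
  assumes "left_ideal I R" "x \<in> I" "y \<in> carrier R" "y \<otimes> x = \<one>"
  shows "I = carrier R"
proof
  have mul: "z \<otimes> w \<in> I" if "z \<in> carrier R" "w \<in> I" for z w
    using assms(1) that by (simp add: left_ideal_def)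
  show "carrier R \<subseteq> I"
  proof
    fix z assume z: "z \<in> carrier R"
    have "z \<otimes> (y \<otimes> x) \<in> I"
      using z assms(2,3) by (intro mul)
    then show "z \<in> I" using z assms(4) by simp
  qed
qed (rule left_ideal_subset[OF assms(1)])

text \<open>A proper left ideal contains no left-invertible element, so it lies inside
  \<open>V\<close>. Thus \<open>V\<close> is the greatest proper left ideal and hence the only
  maximal one, and the intersection is \<open>V\<close> itself.\<close>

lemma (in ring) jacobson_radical_eqI:
  assumes V: "left_ideal V R" "V \<noteq> carrier R"
    and unit: "\<And>x. x \<in> carrier R \<Longrightarrow> x \<notin> V \<Longrightarrow> \<exists>y \<in> carrier R. y \<otimes> x = \<one>"
  shows "jacobson_radical R = V"
proof -
  have proper: "I \<subseteq> V" if "left_ideal I R" "I \<noteq> carrier R" for I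
  proof
    fix x assume "x \<in> I"
    with that show "x \<in> V"
      using unit[of x] left_ideal_eq_carrierI[OF that(1)] left_ideal_subset[OF that(1)] by blast
  qed
  have "maximal_left_ideal V R"
    using V proper unfolding maximal_left_ideal_def by blast
  moreover have "V \<subseteq> I" if I: "maximal_left_ideal I R" for I
  proof -
    have "I \<subseteq> V"
      using I by (intro proper) (simp_all add: maximal_left_ideal_def)
    then have "V = I \<or> V = carrier R"
      using I V(1) by (simp add: maximal_left_ideal_def)
    with V(2) show ?thesis by simp
  qed
  ultimately show ?thesis
    using left_ideal_subset[OF V(1)] unfolding jacobson_radical_def by blast
qed

section \<open>Ring and module structure of the square matrices\<close>

lemma ring_mat_algebra: "ring (mat_algebra m :: ('a :: field, 'a mat) module)"
proof -
  \<comment> \<open>The last argument of \<open>ring_mat\<close> is the record extension, so the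
    scalar multiplication can be passed there without touching the ring operations.\<close>
  have "mat_algebra m = ring_mat TYPE('a) m \<lparr>smult = (\<cdot>\<^sub>m)\<rparr>"
    by (simp add: module_mat_def ring_mat_def)
  then show ?thesis by (simp add: ring_mat)
qed

lemma module_mat_algebra:
  "Module.module class_ring (mat_algebra m :: ('a :: field, 'a mat) module)"
  using matrix_vs[where 'a='a] by (simp add: vectorspace_def)

lemma a_inv_mat_algebra:
  assumes "A \<in> carrier_mat m m"
  shows "\<ominus>\<^bsub>mat_algebra m :: ('a :: field, 'a mat) module\<^esub> A = - A"
proof -
  interpret ring "mat_algebra m :: ('a, 'a mat) module" by (rule ring_mat_algebra)
  have "(- A) \<oplus>\<^bsub>mat_algebra m\<^esub> A = \<zero>\<^bsub>mat_algebra m\<^esub>"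
    using assms by (simp add: module_mat_simps)
  then show ?thesis
    using assms by (intro minus_equality) (simp_all add: module_mat_simps)
qed

lemma additive_subgroup_mat_algebraI:
  fixes W :: "'a :: field mat set"
  assumes "W \<subseteq> carrier_mat m m" "0\<^sub>m m m \<in> W"
    and "\<And>A. A \<in> W \<Longrightarrow> - A \<in> W"
    and "\<And>A B. A \<in> W \<Longrightarrow> B \<in> W \<Longrightarrow> A + B \<in> W"
  shows "additive_subgroup W (mat_algebra m)"
proof -
  interpret ring "mat_algebra m :: ('a, 'a mat) module" by (rule ring_mat_algebra)
  have "subgroup W (add_monoid (mat_algebra m))"
    using assms
    by (intro add.subgroupI) (auto simp: module_mat_simps a_inv_mat_algebra subset_iff)
  then show ?thesis by (rule additive_subgroupI)
qed

section \<open>The regular subgroup and its group operations\<close>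

locale regular_affine_subgroup =
  fixes n :: nat and R V L :: "'a :: field mat set"
  assumes regular: "regular_subgroup n R"
    and V_eq: "V = (\<lambda>A. A - 1\<^sub>m (n + 1)) ` R"
    and L_eq: "L = {a \<cdot>\<^sub>m 1\<^sub>m (n + 1) + x | a x. x \<in> V}"
begin

abbreviation N where "N \<equiv> n + 1"

lemma R_subgroup: "subgroup R (AGL n)"
  using regular by (simp add: regular_subgroup_def)

lemma R_Units: "A \<in> R \<Longrightarrow> A \<in> Units (mat_algebra N)"
  and R_col_0: "A \<in> R \<Longrightarrow> col A 0 = unit_vec N 0"
  using subgroup.subset[OF R_subgroup] by (auto simp: AGL_def GL_def units_of_def)

lemma R_carrier: "A \<in> R \<Longrightarrow> A \<in> carrier_mat N N"
  using R_Units[of A] by (auto simp: Units_def module_mat_simps)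

lemma one_in_R: "1\<^sub>m N \<in> R"
  using subgroup.one_closed[OF R_subgroup]
  by (simp add: AGL_def GL_def units_of_def module_mat_simps)

lemma R_mult: "A \<in> R \<Longrightarrow> B \<in> R \<Longrightarrow> A * B \<in> R"
  using subgroup.m_closed[OF R_subgroup]
  by (simp add: AGL_def GL_def units_of_def module_mat_simps)

text \<open>The inverse in \<open>AGL n\<close> is a definite description over the carrier of
  \<open>AGL n\<close>. It agrees with the matrix inverse \<open>B\<close> once \<open>B\<close> is
  known to lie in that carrier, and closure of \<open>R\<close> under inverses then puts
  \<open>B\<close> into \<open>R\<close>.\<close>

lemma R_inverse:
  assumes "A \<in> R"
  shows "\<exists>B \<in> R. B * A = 1\<^sub>m N"
proof -
  obtain B where B: "B \<in> carrier_mat N N" "A * B = 1\<^sub>m N" "B * A = 1\<^sub>m N"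
    using R_Units[OF assms] by (auto simp: Units_def module_mat_simps)
  note A = R_carrier[OF assms]
  \<comment> \<open>The first column is the image of the first unit vector. \<open>A\<close> fixes
    that vector, hence so does its inverse \<open>B\<close>.\<close>
  have "col B 0 = B *\<^sub>v unit_vec N 0"
    using B(1) by (intro eq_vecI) auto
  also have "unit_vec N 0 = A *\<^sub>v unit_vec N 0"
    using A R_col_0[OF assms] by (intro eq_vecI) (auto simp: col_def vec_eq_iff)
  also have "B *\<^sub>v (A *\<^sub>v unit_vec N 0) = unit_vec N 0"
    using A B by (simp flip: assoc_mult_mat_vec)
  finally have colB: "col B 0 = unit_vec N 0" .
  have "inv\<^bsub>AGL n\<^esub> A = B"
    unfolding m_inv_def
  proof (rule the_equality)
    show "B \<in> carrier (AGL n) \<and> A \<otimes>\<^bsub>AGL n\<^esub> B = \<one>\<^bsub>AGL n\<^esub> \<and> B \<otimes>\<^bsub>AGL n\<^esub> A = \<one>\<^bsub>AGL n\<^esub>"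
      using A B colB
      by (auto simp: AGL_def GL_def units_of_def Units_def module_mat_simps)
    show "C = B"
      if "C \<in> carrier (AGL n) \<and> A \<otimes>\<^bsub>AGL n\<^esub> C = \<one>\<^bsub>AGL n\<^esub> \<and> C \<otimes>\<^bsub>AGL n\<^esub> A = \<one>\<^bsub>AGL n\<^esub>" for C
    proof -
      have C: "C \<in> carrier_mat N N" "C * A = 1\<^sub>m N"
        using that by (auto simp: AGL_def GL_def units_of_def Units_def module_mat_simps)
      have "C = C * (A * B)" using B C by simp
      also have "\<dots> = C * A * B" using A B C by (intro assoc_mult_mat[symmetric])
      also have "\<dots> = B" using B C by simp
      finally show ?thesis .
    qed
  qed
  moreover have "inv\<^bsub>AGL n\<^esub> A \<in> R"
    using subgroup.m_inv_closed[OF R_subgroup assms] .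
  ultimately show ?thesis using B by auto
qed

section \<open>Parametrization of \<open>V\<close> by first rows\<close>

text \<open>The shape of the members of \<open>V\<close>, with the lower block left free: sums and
  multiples of members keep this shape before it is known whether they belong to
  \<open>V\<close>.\<close>

definition nil_block :: "'a vec \<Rightarrow> 'a mat \<Rightarrow> 'a mat" where
  "nil_block v D = four_block_mat (0\<^sub>m 1 1) (mat_of_rows n [v]) (0\<^sub>m n 1) D"

lemma nil_block_carrier: "D \<in> carrier_mat n n \<Longrightarrow> nil_block v D \<in> carrier_mat N N"
  by (auto simp: nil_block_def)

lemma nil_block_index:
  assumes "D \<in> carrier_mat n n"
  shows "j < N \<Longrightarrow> nil_block v D $$ (0, j) = (if j = 0 then 0 else v $ (j - 1))"
    and "i < n \<Longrightarrow> j < N \<Longrightarrow> nil_block v D $$ (Suc i, j) = (if j = 0 then 0 else D $$ (i, j - 1))"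
  using assms by (auto simp: nil_block_def mat_of_rows_def)

lemma nil_block_inject:
  assumes "nil_block v D = nil_block w E" "v \<in> carrier_vec n" "w \<in> carrier_vec n"
    "D \<in> carrier_mat n n" "E \<in> carrier_mat n n"
  shows "v = w" "D = E"
proof -
  show "v = w"
  proof (rule eq_vecI)
    show "v $ i = w $ i" if "i < dim_vec w" for i
      using assms(3) that nil_block_index(1)[OF assms(4), of "Suc i" v]
        nil_block_index(1)[OF assms(5), of "Suc i" w] assms(1) by simp
  qed (use assms in auto)
  show "D = E"
  proof (rule eq_matI)
    show "D $$ (i, j) = E $$ (i, j)" if "i < dim_row E" "j < dim_col E" for i j
      using assms(5) that nil_block_index(2)[OF assms(4), of i "Suc j" v]
        nil_block_index(2)[OF assms(5), of i "Suc j" w] assms(1) by simp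
  qed (use assms in auto)
qed

lemma nil_block_eqI:
  assumes "A \<in> carrier_mat N N" "D \<in> carrier_mat n n"
    and "A $$ (0, 0) = 0" "\<And>i. i < n \<Longrightarrow> A $$ (Suc i, 0) = 0"
    and "\<And>j. j < n \<Longrightarrow> A $$ (0, Suc j) = v $ j"
    and "\<And>i j. i < n \<Longrightarrow> j < n \<Longrightarrow> A $$ (Suc i, Suc j) = D $$ (i, j)"
  shows "A = nil_block v D"
proof (rule eq_matI)
  fix i j
  assume "i < dim_row (nil_block v D)" "j < dim_col (nil_block v D)"
  then have "i < N" "j < N"
    using nil_block_carrier[OF assms(2), of v] by auto
  then show "A $$ (i, j) = nil_block v D $$ (i, j)"
    by (cases i; cases j) (simp_all add: nil_block_index[OF assms(2)] assms(3-6))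
qed (use assms nil_block_carrier[OF assms(2), of v] in auto)

lemma nil_block_add:
  assumes "v \<in> carrier_vec n" "w \<in> carrier_vec n" "D \<in> carrier_mat n n" "E \<in> carrier_mat n n"
  shows "nil_block v D + nil_block w E = nil_block (v + w) (D + E)"
  using assms nil_block_carrier[of D v] nil_block_carrier[of E w]
  by (intro nil_block_eqI) (auto simp: nil_block_index)

lemma nil_block_smult:
  assumes "v \<in> carrier_vec n" "D \<in> carrier_mat n n"
  shows "a \<cdot>\<^sub>m nil_block v D = nil_block (a \<cdot>\<^sub>v v) (a \<cdot>\<^sub>m D)"
  using assms nil_block_carrier[of D v]
  by (intro nil_block_eqI) (auto simp: nil_block_index)

lemma mu_unique: "v \<in> carrier_vec n \<Longrightarrow> \<exists>!A. A \<in> R \<and> row A 0 = vCons 1 v"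
  using regular by (simp add: regular_subgroup_def)

lemma mu_in_R: "v \<in> carrier_vec n \<Longrightarrow> mu R v \<in> R"
  and row_mu: "v \<in> carrier_vec n \<Longrightarrow> row (mu R v) 0 = vCons 1 v"
  using theI'[OF mu_unique] by (auto simp: mu_def)

lemma delta_carrier: "v \<in> carrier_vec n \<Longrightarrow> delta R v \<in> carrier_mat n n"
  by (auto simp: delta_def intro: minus_carrier_mat)

lemma mu_minus_one:
  assumes v: "v \<in> carrier_vec n"
  shows "mu R v - 1\<^sub>m N = nil_block v (delta R v)"
proof (rule nil_block_eqI[OF _ delta_carrier[OF v]])
  note A = R_carrier[OF mu_in_R[OF v]]
  have row: "mu R v $$ (0, j) = vCons 1 v $ j" if "j < N" for j
    using A row_mu[OF v] that by (metis carrier_matD index_row(1) zero_less_Suc Suc_eq_plus1)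
  have col: "mu R v $$ (i, 0) = unit_vec N 0 $ i" if "i < N" for i
    using A R_col_0[OF mu_in_R[OF v]] that
    by (metis carrier_matD index_col zero_less_Suc Suc_eq_plus1)
  show "mu R v - 1\<^sub>m N \<in> carrier_mat N N" using A by auto
  show "(mu R v - 1\<^sub>m N) $$ (0, 0) = 0" using row[of 0] by simp
  show "(mu R v - 1\<^sub>m N) $$ (Suc i, 0) = 0" if "i < n" for i
    using col[of "Suc i"] that by simp
  show "(mu R v - 1\<^sub>m N) $$ (0, Suc j) = v $ j" if "j < n" for j
    using row[of "Suc j"] that v by simp
  \<comment> \<open>Deleting row and column 0 shifts both indices by one, and the shifted diagonal
    of \<open>1\<^sub>m N\<close> is that of the identity subtracted in
    \<open>delta\<close>.\<close>
  show "(mu R v - 1\<^sub>m N) $$ (Suc i, Suc j) = delta R v $$ (i, j)" if "i < n" "j < n" for i j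
    using that v A by (auto simp: delta_def mat_delete_def)
qed

text \<open>By the uniqueness in regularity, every member of \<open>R\<close> is the value of
  \<open>mu R\<close> at the vector read off its own first row, so \<open>mu R\<close> parametrizes
  all of \<open>R\<close>.\<close>

lemma V_nil_block: "V = {nil_block v (delta R v) | v. v \<in> carrier_vec n}"
proof -
  have "\<exists>v \<in> carrier_vec n. A = mu R v" if "A \<in> R" for A
  proof
    define v where "v = vec n (\<lambda>j. A $$ (0, Suc j))"
    show v: "v \<in> carrier_vec n" by (simp add: v_def)
    note A = R_carrier[OF that]
    \<comment> \<open>Regularity speaks only of first rows that start with 1; here that entry comes
      from the prescribed first column.\<close>
    have "A $$ (0, 0) = col A 0 $ 0" using A by simp
    then have "A $$ (0, 0) = 1" using R_col_0[OF that] by simp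
    then have "row A 0 = vCons 1 v"
      using A by (intro eq_vecI) (auto simp: v_def vec_index_vCons)
    then show "A = mu R v"
      using mu_unique[OF v] mu_in_R[OF v] row_mu[OF v] that by blast
  qed
  then have "R = mu R ` carrier_vec n"
    using mu_in_R by blast
  then have "V = (\<lambda>v. mu R v - 1\<^sub>m N) ` carrier_vec n"
    unfolding V_eq by (metis (no_types, lifting) image_cong image_image)
  then show ?thesis
    using mu_minus_one by (auto simp: image_iff)
qed

lemma V_carrier: "x \<in> V \<Longrightarrow> x \<in> carrier_mat N N"
  using V_eq R_carrier by auto

lemma V_index_0: "x \<in> V \<Longrightarrow> i < N \<Longrightarrow> x $$ (i, 0) = 0"
  using delta_carrier by (cases i) (auto simp: V_nil_block nil_block_index)

lemma zero_in_V: "0\<^sub>m N N \<in> V"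
proof -
  have "1\<^sub>m N - 1\<^sub>m N = (0\<^sub>m N N :: 'a mat)" by auto
  then show ?thesis using one_in_R V_eq by (metis image_eqI)
qed

text \<open>The first row \<open>v\<close> already singles out one member of \<open>V\<close>, whose
  lower block is \<open>delta R v\<close>. This turns membership in \<open>V\<close> into an
  equation for \<open>delta R\<close>.\<close>

lemma nil_block_in_V_iff:
  assumes "v \<in> carrier_vec n" "D \<in> carrier_mat n n"
  shows "nil_block v D \<in> V \<longleftrightarrow> D = delta R v"
  using assms delta_carrier nil_block_inject unfolding V_nil_block by blast

section \<open>Additivity and linearity of \<open>delta R\<close> as closure properties of
  \<open>V\<close>\<close>

text \<open>The sum of two parametrized members has first row \<open>v + w\<close>, so by
  \<open>nil_block_in_V_iff\<close> it lies in \<open>V\<close> exactly when its lower block is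
  \<open>delta R (v + w)\<close>. Scalar multiples are treated in the same way below.\<close>

lemma V_add_iff:
  "(\<forall>v \<in> carrier_vec n. \<forall>w \<in> carrier_vec n. delta R (v + w) = delta R v + delta R w)
    \<longleftrightarrow> (\<forall>x \<in> V. \<forall>y \<in> V. x + y \<in> V)"
proof -
  have "nil_block v (delta R v) + nil_block w (delta R w) \<in> V
      \<longleftrightarrow> delta R (v + w) = delta R v + delta R w"
    if "v \<in> carrier_vec n" "w \<in> carrier_vec n" for v w
    using that delta_carrier nil_block_in_V_iff[of "v + w" "delta R v + delta R w"]
    by (auto simp: nil_block_add)
  then show ?thesis
    unfolding V_nil_block[unfolded Setcompr_eq_image] by auto
qed

lemma V_smult_iff:
  "(\<forall>a. \<forall>v \<in> carrier_vec n. delta R (a \<cdot>\<^sub>v v) = a \<cdot>\<^sub>m delta R v)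
    \<longleftrightarrow> (\<forall>a. \<forall>x \<in> V. a \<cdot>\<^sub>m x \<in> V)"
proof -
  have "a \<cdot>\<^sub>m nil_block v (delta R v) \<in> V \<longleftrightarrow> delta R (a \<cdot>\<^sub>v v) = a \<cdot>\<^sub>m delta R v"
    if "v \<in> carrier_vec n" for a v
    using that delta_carrier nil_block_in_V_iff[of "a \<cdot>\<^sub>v v" "a \<cdot>\<^sub>m delta R v"]
    by (auto simp: nil_block_smult)
  then show ?thesis
    unfolding V_nil_block[unfolded Setcompr_eq_image] by auto
qed

lemma linear_delta_iff:
  "linear_map class_ring (module_vec TYPE('a) n) (mat_algebra n) (delta R)
    \<longleftrightarrow> (\<forall>x \<in> V. \<forall>y \<in> V. x + y \<in> V) \<and> (\<forall>a. \<forall>x \<in> V. a \<cdot>\<^sub>m x \<in> V)"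
  unfolding V_add_iff[symmetric] V_smult_iff[symmetric]
  by (auto simp: linear_map_def mod_hom_def mod_hom_axioms_def LinearCombinations.module_hom_def
      vec_vs matrix_vs vec_module module_mat_algebra module_vec_simps module_mat_simps
      delta_carrier)

section \<open>Multiplicative closure of \<open>V\<close>\<close>

lemma one_plus_V: "x \<in> V \<Longrightarrow> 1\<^sub>m N + x \<in> R"
proof -
  assume "x \<in> V"
  then obtain A where A: "A \<in> R" "x = A - 1\<^sub>m N" by (auto simp: V_eq)
  then have "1\<^sub>m N + x = A" using R_carrier[OF A(1)] by (intro eq_matI) auto
  then show ?thesis using A(1) by simp
qed

text \<open>With $x = A - 1$ and $y = B - 1$ one has $xy = (AB - 1) - x - y$, so closure under
  multiplication comes from the group structure of \<^term>\<open>R\<close> as soon as \<^term>\<open>V\<close> is an additive group.\<close>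

lemma nonunital_subring_V:
  assumes add: "\<And>x y. x \<in> V \<Longrightarrow> y \<in> V \<Longrightarrow> x + y \<in> V"
  shows "nonunital_subring V (mat_algebra N)"
proof -
  have neg: "- x \<in> V" if "x \<in> V" for x
  proof -
    obtain v where v: "v \<in> carrier_vec n" "x = nil_block v (delta R v)"
      using \<open>x \<in> V\<close> by (auto simp: V_nil_block)
    \<comment> \<open>The candidate for \<open>- x\<close> is the member of \<open>V\<close> with
      first row \<open>- v\<close>. Then \<open>x + y\<close> lies in \<open>V\<close> and has first
      row zero, as does the zero matrix, so the two coincide.\<close>
    define y where "y = nil_block (- v) (delta R (- v))"
    have y: "y \<in> V" using v by (auto simp: V_nil_block y_def)
    note D = delta_carrier[OF v(1)] delta_carrier[of "- v"]
    have v0: "v + - v = 0\<^sub>v n" using v by auto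
    have "nil_block (0\<^sub>v n) (delta R v + delta R (- v)) \<in> V"
      using add[OF \<open>x \<in> V\<close> y] v D v0 by (simp add: y_def nil_block_add)
    then have "delta R v + delta R (- v) = delta R (0\<^sub>v n)"
      using v D nil_block_in_V_iff[of "0\<^sub>v n"] by simp
    moreover have "0\<^sub>m N N = nil_block (0\<^sub>v n) (0\<^sub>m n n)"
      by (intro nil_block_eqI) auto
    then have "0\<^sub>m n n = delta R (0\<^sub>v n)"
      using zero_in_V nil_block_in_V_iff[of "0\<^sub>v n" "0\<^sub>m n n"] by simp
    ultimately have "x + y = 0\<^sub>m N N"
      using v D v0 \<open>0\<^sub>m N N = _\<close> by (simp add: y_def nil_block_add)
    then have "- x = y"
      using V_carrier[OF \<open>x \<in> V\<close>] V_carrier[OF y]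
      by (metis assoc_add_mat left_add_zero_mat right_add_zero_mat uminus_carrier_iff_mat uminus_l_inv_mat)
    then show ?thesis using y by simp
  qed
  have "x * y \<in> V" if x: "x \<in> V" and y: "y \<in> V" for x y
  proof -
    note xy = V_carrier[OF x] V_carrier[OF y]
    have "(1\<^sub>m N + x) * (1\<^sub>m N + y) - 1\<^sub>m N \<in> V"
      using one_plus_V[OF x] one_plus_V[OF y] R_mult by (auto simp: V_eq)
    moreover have "(1\<^sub>m N + x) * (1\<^sub>m N + y) = (1\<^sub>m N + x) + (y + x * y)"
    proof -
      have "(1\<^sub>m N + x) * (1\<^sub>m N + y) = (1\<^sub>m N + x) * 1\<^sub>m N + (1\<^sub>m N + x) * y"
        using xy by (intro mult_add_distrib_mat[of _ N N _ N]) auto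
      also have "(1\<^sub>m N + x) * y = 1\<^sub>m N * y + x * y"
        using xy by (intro add_mult_distrib_mat[of _ N N _ _ N]) auto
      also have "1\<^sub>m N * y = y" using xy(2) by (rule left_mult_one_mat)
      also have "(1\<^sub>m N + x) * 1\<^sub>m N = 1\<^sub>m N + x" using xy by (intro right_mult_one_mat) auto
      finally show ?thesis .
    qed
    moreover have "x * y = ((1\<^sub>m N + x) + (y + x * y) - 1\<^sub>m N) + (- x + - y)"
      using xy by (intro eq_matI) auto
    ultimately show ?thesis
      using add neg x y by metis
  qed
  then show ?thesis
    using add neg zero_in_V V_carrier
    by (auto simp: nonunital_subring_def module_mat_simps
        intro!: additive_subgroup_mat_algebraI)
qed

section \<open>Elements and products of \<open>L\<close>\<close>

lemma V_subset_L: "V \<subseteq> L"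
proof
  fix x assume "x \<in> V"
  moreover have "x = 0 \<cdot>\<^sub>m 1\<^sub>m N + x"
    using V_carrier[OF \<open>x \<in> V\<close>] by (intro eq_matI) auto
  ultimately show "x \<in> L" unfolding L_eq by blast
qed

lemma L_index_0: "x \<in> V \<Longrightarrow> (a \<cdot>\<^sub>m 1\<^sub>m N + x) $$ (0, 0) = a"
  using V_carrier[of x] V_index_0[of x 0] by auto

lemma L_carrier: "A \<in> L \<Longrightarrow> A \<in> carrier_mat N N"
  using V_carrier by (auto simp: L_eq)

text \<open>Scalar parts multiply, and the remaining three terms lie in \<open>V\<close> as soon as
  \<open>V\<close> is a subspace closed under products. This yields both closure of \<open>L\<close>
  and multiplicativity of the (0, 0) entry.\<close>

lemma L_mult:
  assumes x: "x \<in> V" and y: "y \<in> V"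
  shows "(a \<cdot>\<^sub>m 1\<^sub>m N + x) * (b \<cdot>\<^sub>m 1\<^sub>m N + y)
    = (a * b) \<cdot>\<^sub>m 1\<^sub>m N + (a \<cdot>\<^sub>m y + b \<cdot>\<^sub>m x + x * y)"
proof -
  note xy = V_carrier[OF x] V_carrier[OF y]
  have "(a \<cdot>\<^sub>m 1\<^sub>m N + x) * (b \<cdot>\<^sub>m 1\<^sub>m N + y)
      = (a \<cdot>\<^sub>m 1\<^sub>m N + x) * (b \<cdot>\<^sub>m 1\<^sub>m N) + (a \<cdot>\<^sub>m 1\<^sub>m N + x) * y"
    using xy by (intro mult_add_distrib_mat[of _ N N _ N]) auto
  also have "(a \<cdot>\<^sub>m 1\<^sub>m N + x) * (b \<cdot>\<^sub>m 1\<^sub>m N) = b \<cdot>\<^sub>m ((a \<cdot>\<^sub>m 1\<^sub>m N + x) * 1\<^sub>m N)"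
    using xy by (intro mult_smult_distrib[of _ N N _ N]) auto
  also have "(a \<cdot>\<^sub>m 1\<^sub>m N + x) * 1\<^sub>m N = a \<cdot>\<^sub>m 1\<^sub>m N + x"
    using xy by (intro right_mult_one_mat) auto
  also have "(a \<cdot>\<^sub>m 1\<^sub>m N + x) * y = (a \<cdot>\<^sub>m 1\<^sub>m N) * y + x * y"
    using xy by (intro add_mult_distrib_mat[of _ N N _ _ N]) auto
  also have "(a \<cdot>\<^sub>m 1\<^sub>m N) * y = a \<cdot>\<^sub>m (1\<^sub>m N * y)"
    using xy by (intro mult_smult_assoc_mat[of _ N N _ N]) auto
  also have "1\<^sub>m N * y = y" using xy(2) by (rule left_mult_one_mat)
  also have "b \<cdot>\<^sub>m (a \<cdot>\<^sub>m 1\<^sub>m N + x) + (a \<cdot>\<^sub>m y + x * y)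
      = (a * b) \<cdot>\<^sub>m 1\<^sub>m N + (a \<cdot>\<^sub>m y + b \<cdot>\<^sub>m x + x * y)"
    using xy by (intro eq_matI) (auto simp: algebra_simps)
  finally show ?thesis .
qed

abbreviation L_algebra where
  "L_algebra \<equiv> (mat_algebra N :: ('a, 'a mat) module)\<lparr>carrier := L\<rparr>"

section \<open>The algebra \<open>L\<close> when \<open>V\<close> is a subspace\<close>

context
  assumes V_add: "\<And>x y. x \<in> V \<Longrightarrow> y \<in> V \<Longrightarrow> x + y \<in> V"
    and V_smult: "\<And>a x. x \<in> V \<Longrightarrow> a \<cdot>\<^sub>m x \<in> V"
begin

lemma V_mult: "x \<in> V \<Longrightarrow> y \<in> V \<Longrightarrow> x * y \<in> V"
  using nonunital_subring_V[OF V_add] by (simp add: nonunital_subring_def module_mat_simps)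

lemma additive_subgroup_V: "additive_subgroup V (mat_algebra N)"
  using nonunital_subring_V[OF V_add] by (simp add: nonunital_subring_def)

lemma L_I: "x \<in> V \<Longrightarrow> a \<cdot>\<^sub>m 1\<^sub>m N + x \<in> L"
  unfolding L_eq by blast

text \<open>The scalar part can be recovered as the (0, 0) entry because members of \<open>V\<close>
  have zero first column.\<close>

lemma L_E:
  assumes "A \<in> L"
  obtains x where "x \<in> V" "A = (A $$ (0, 0)) \<cdot>\<^sub>m 1\<^sub>m N + x"
proof -
  obtain a x where "x \<in> V" "A = a \<cdot>\<^sub>m 1\<^sub>m N + x"
    using assms unfolding L_eq by blast
  then show ?thesis using that[of x] L_index_0[of x a] by simp
qed

lemma L_mult_index_0:
  assumes "A \<in> L" "B \<in> L"
  shows "A * B \<in> L" "(A * B) $$ (0, 0) = A $$ (0, 0) * B $$ (0, 0)"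
proof -
  obtain x where x: "x \<in> V" "A = (A $$ (0, 0)) \<cdot>\<^sub>m 1\<^sub>m N + x"
    using L_E[OF assms(1)] .
  obtain y where y: "y \<in> V" "B = (B $$ (0, 0)) \<cdot>\<^sub>m 1\<^sub>m N + y"
    using L_E[OF assms(2)] .
  define a b where "a = A $$ (0, 0)" and "b = B $$ (0, 0)"
  have z: "a \<cdot>\<^sub>m y + b \<cdot>\<^sub>m x + x * y \<in> V"
    using x(1) y(1) by (intro V_add V_smult V_mult)
  have "A * B = (a * b) \<cdot>\<^sub>m 1\<^sub>m N + (a \<cdot>\<^sub>m y + b \<cdot>\<^sub>m x + x * y)"
    using L_mult[OF x(1) y(1), of a b] x(2) y(2) by (simp add: a_def b_def)
  then show "A * B \<in> L" "(A * B) $$ (0, 0) = A $$ (0, 0) * B $$ (0, 0)"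
    using L_I[OF z] L_index_0[OF z] by (simp_all add: a_def b_def)
qed

lemma L_add:
  assumes "A \<in> L" "B \<in> L"
  shows "A + B \<in> L"
proof -
  obtain a x b y where *: "x \<in> V" "A = a \<cdot>\<^sub>m 1\<^sub>m N + x" "y \<in> V" "B = b \<cdot>\<^sub>m 1\<^sub>m N + y"
    using assms unfolding L_eq by blast
  have "A + B = (a + b) \<cdot>\<^sub>m 1\<^sub>m N + (x + y)"
    using V_carrier[OF *(1)] V_carrier[OF *(3)]
    unfolding *(2,4) by (intro eq_matI) (auto simp: algebra_simps)
  then show ?thesis using L_I[OF V_add[OF *(1,3)]] by simp
qed

lemma L_smult:
  assumes "A \<in> L"
  shows "c \<cdot>\<^sub>m A \<in> L"
proof -
  obtain a x where *: "x \<in> V" "A = a \<cdot>\<^sub>m 1\<^sub>m N + x"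
    using assms unfolding L_eq by blast
  have "c \<cdot>\<^sub>m A = (c * a) \<cdot>\<^sub>m 1\<^sub>m N + c \<cdot>\<^sub>m x"
    using V_carrier[OF *(1)] unfolding *(2) by (intro eq_matI) (auto simp: algebra_simps)
  then show ?thesis using L_I[OF V_smult[OF *(1)]] by simp
qed

lemma R_subset_L: "A \<in> R \<Longrightarrow> A \<in> L"
proof -
  assume A: "A \<in> R"
  then have "A - 1\<^sub>m N \<in> V" by (auto simp: V_eq)
  moreover have "A = 1 \<cdot>\<^sub>m 1\<^sub>m N + (A - 1\<^sub>m N)"
    using R_carrier[OF A] by (intro eq_matI) auto
  ultimately show "A \<in> L" unfolding L_eq by blast
qed

lemma subring_L: "subring L (mat_algebra N)"
proof -
  interpret M: ring "mat_algebra N :: ('a, 'a mat) module" by (rule ring_mat_algebra)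
  have "- A \<in> L" if "A \<in> L" for A
  proof -
    have "- A = (- 1) \<cdot>\<^sub>m A" by (intro eq_matI) auto
    then show ?thesis using L_smult[OF that] by simp
  qed
  then show ?thesis
    using L_carrier L_add L_mult_index_0(1) R_subset_L[OF one_in_R]
    by (intro M.subringI) (auto simp: module_mat_simps a_inv_mat_algebra)
qed

lemma unital_subalgebra_L: "unital_subalgebra class_ring L (mat_algebra N)"
  using subring_L L_smult by (simp add: unital_subalgebra_def module_mat_simps)

lemma ring_L: "ring L_algebra"
  using ring.subring_is_ring[OF ring_mat_algebra subring_L] .

lemma assoc_algebra_L: "assoc_algebra class_ring L_algebra"
proof -
  have "0\<^sub>m N N \<in> L" using zero_in_V V_subset_L by blast
  then have "submodule class_ring L (mat_algebra N)"
    using L_carrier L_add L_smult module_mat_algebra[of N]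
    by (auto simp: submodule_def module_mat_simps)
  then have "Module.module class_ring L_algebra"
    using module.submodule_is_module[OF module_mat_algebra] by blast
  then show ?thesis
    using ring_L L_carrier
    by (auto simp: assoc_algebra_def module_mat_simps
        intro: mult_smult_assoc_mat[of _ N N _ N] mult_smult_distrib[of _ N N _ N])
qed

text \<open>This describes \<open>V\<close> as the kernel of the (0, 0) entry on \<open>L\<close>.
  Since that entry is multiplicative on \<open>L\<close>, the ideal property of \<open>V\<close>
  follows.\<close>

lemma V_iff: "A \<in> V \<longleftrightarrow> A \<in> L \<and> A $$ (0, 0) = 0"
proof
  assume A: "A \<in> L \<and> A $$ (0, 0) = 0"
  then obtain x where x: "x \<in> V" "A = (A $$ (0, 0)) \<cdot>\<^sub>m 1\<^sub>m N + x"
    using L_E by blast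
  then have "A = 0 \<cdot>\<^sub>m 1\<^sub>m N + x" using A by simp
  also have "\<dots> = x" using V_carrier[OF x(1)] by (intro eq_matI) auto
  finally show "A \<in> V" using x(1) by simp
qed (use V_subset_L V_index_0 in auto)

lemma left_ideal_V: "left_ideal V L_algebra"
proof -
  interpret M: ring "mat_algebra N :: ('a, 'a mat) module" by (rule ring_mat_algebra)
  have "subgroup V (add_monoid (mat_algebra N)\<lparr>carrier := L\<rparr>)"
    using additive_subgroup_V subring_L V_subset_L
    by (intro M.add.subgroup_incl) (simp_all add: additive_subgroup_def subring_def)
  then show ?thesis
    using L_mult_index_0 by (auto simp: left_ideal_def additive_subgroup_def module_mat_simps V_iff)
qed

text \<open>Dividing by the nonzero (0, 0) entry moves the matrix into \<open>R\<close>. The inverse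
  taken there stays in \<open>R\<close>, hence in \<open>L\<close>, and scaling it back inverts the
  original matrix inside \<open>L\<close>.\<close>

lemma L_unit:
  assumes A: "A \<in> L" "A \<notin> V"
  shows "\<exists>B \<in> L. B * A = 1\<^sub>m N"
proof -
  obtain x where x: "x \<in> V" "A = (A $$ (0, 0)) \<cdot>\<^sub>m 1\<^sub>m N + x"
    using L_E[OF A(1)] .
  define a where "a = A $$ (0, 0)"
  have a: "a \<noteq> 0" using A by (simp add: V_iff a_def)
  have A_eq: "A = a \<cdot>\<^sub>m 1\<^sub>m N + x" using x(2) by (simp add: a_def)
  have "inverse a \<cdot>\<^sub>m A = 1\<^sub>m N + inverse a \<cdot>\<^sub>m x"
    using V_carrier[OF x(1)] a unfolding A_eq by (intro eq_matI) (auto simp: field_simps)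
  then have "inverse a \<cdot>\<^sub>m A \<in> R"
    using one_plus_V[OF V_smult[OF x(1)]] by simp
  then obtain B where B: "B \<in> R" "B * (inverse a \<cdot>\<^sub>m A) = 1\<^sub>m N"
    using R_inverse by blast
  have "(inverse a \<cdot>\<^sub>m B) * A = 1\<^sub>m N"
    using mult_smult_assoc_mat[OF R_carrier[OF B(1)] L_carrier[OF A(1)], of "inverse a"]
      mult_smult_distrib[OF R_carrier[OF B(1)] L_carrier[OF A(1)], of "inverse a"] B(2)
    by simp
  then show ?thesis
    using L_smult[OF R_subset_L[OF B(1)]] by blast
qed

lemma jacobson_radical_L: "jacobson_radical L_algebra = V"
proof -
  interpret A: ring L_algebra by (rule ring_L)
  have "1\<^sub>m N \<in> L" "1\<^sub>m N \<notin> V"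
    using R_subset_L[OF one_in_R] by (auto simp: V_iff)
  then show ?thesis
    using left_ideal_V L_unit
    by (intro A.jacobson_radical_eqI) (auto simp: module_mat_simps)
qed

lemma split_local_L: "split_local class_ring L_algebra"
proof -
  \<comment> \<open>The map \<open>h\<close> is the projection of \<open>L\<close> to its scalar
    part. It is a surjective ring homomorphism with kernel \<open>V\<close>, so the first
    isomorphism theorem gives the quotient.\<close>
  define h :: "'a mat \<Rightarrow> 'a" where "h A = A $$ (0, 0)" for A
  have "(A + B) $$ (0, 0) = A $$ (0, 0) + B $$ (0, 0)" if "B \<in> L" for A B
    using L_carrier[OF that] by auto
  then have "ring_hom_ring L_algebra class_ring h"
    using ring_L class_ring.ring_axioms L_mult_index_0(2)
    by (intro ring_hom_ringI) (auto simp: module_mat_simps h_def)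
  then interpret h: ring_hom_ring L_algebra class_ring h .
  have ker: "a_kernel L_algebra class_ring h = V"
    by (auto simp: a_kernel_def' h_def V_iff)
  \<comment> \<open>The scalar matrix, with zero as its \<open>V\<close>-part, is a preimage of
    \<open>a\<close>.\<close>
  have "a \<in> h ` L" for a
    using L_I[OF zero_in_V, of a] L_index_0[OF zero_in_V, of a] by (force simp: h_def)
  then have "h ` carrier L_algebra = carrier class_ring" by auto
  note iso = h.FactRing_iso_set[OF this, unfolded ker]
  \<comment> \<open>The induced isomorphism sends a coset to the single value that \<open>h\<close>
    takes on it; its linearity thus reduces to that of \<open>h\<close> on representatives.\<close>
  have "the_elem (h ` (V +>\<^bsub>L_algebra\<^esub> A)) = h A" if "A \<in> L" for A
    using h.the_elem_simp[of A, unfolded ker] that by simp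
  moreover have "h (a \<cdot>\<^sub>m A) = a * h A" if "A \<in> L" for a A
    using L_carrier[OF that] by (auto simp: h_def)
  ultimately show ?thesis
    using assoc_algebra_L iso L_smult
    unfolding split_local_def jacobson_radical_L
    by (auto simp: module_mat_simps intro!: bexI[of _ "\<lambda>X. the_elem (h ` X)"])
qed

end

section \<open>From the Jacobson radical back to linearity\<close>

text \<open>That \<open>L\<close> is a subring makes \<open>L_algebra\<close> a ring, so its radical
  \<open>V\<close> is a left ideal. Left multiplication by scalar matrices in \<open>L\<close> then
  supplies closure under scalars.\<close>

lemma V_closed_if_jacobson_radical:
  assumes L: "subring L (mat_algebra N)" and J: "jacobson_radical L_algebra = V"
  shows "x \<in> V \<Longrightarrow> y \<in> V \<Longrightarrow> x + y \<in> V" and "x \<in> V \<Longrightarrow> a \<cdot>\<^sub>m x \<in> V"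
proof -
  have ideal: "left_ideal V L_algebra"
    using ring.left_ideal_jacobson_radical[OF ring.subring_is_ring[OF ring_mat_algebra L]] J
    by simp
  then show "x + y \<in> V" if "x \<in> V" "y \<in> V"
    using additive_subgroup.a_closed[of V L_algebra x y] that
    by (simp add: left_ideal_def module_mat_simps)
  show "a \<cdot>\<^sub>m x \<in> V" if x: "x \<in> V"
  proof -
    have "a \<cdot>\<^sub>m 1\<^sub>m N + 0\<^sub>m N N \<in> L" using zero_in_V unfolding L_eq by blast
    then have "(a \<cdot>\<^sub>m 1\<^sub>m N) * x \<in> V"
      using ideal x by (simp add: left_ideal_def module_mat_simps)
    also have "(a \<cdot>\<^sub>m 1\<^sub>m N) * x = a \<cdot>\<^sub>m (1\<^sub>m N * x)"
      using V_carrier[OF x] by (intro mult_smult_assoc_mat[of _ N N _ N]) auto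
    also have "1\<^sub>m N * x = x"
      using V_carrier[OF x] by (rule left_mult_one_mat)
    finally show ?thesis .
  qed
qed

end

theorem theorem3p3:
  fixes n :: nat and R V L :: "'a :: field mat set"
  assumes "regular_subgroup n R"
    and "V = (\<lambda>A. A - 1\<^sub>m (n + 1)) ` R"
    and "L = {a \<cdot>\<^sub>m 1\<^sub>m (n + 1) + x | a x. x \<in> V}"
  shows "V = {four_block_mat (0\<^sub>m 1 1) (mat_of_rows n [v]) (0\<^sub>m n 1) (delta R v) | v.
                v \<in> carrier_vec n} \<and>
         ((\<forall>v \<in> carrier_vec n. \<forall>w \<in> carrier_vec n. delta R (v + w) = delta R v + delta R w)
           \<longrightarrow> nonunital_subring V (mat_algebra (n + 1))) \<and>
         (linear_map class_ring (module_vec TYPE('a) n) (mat_algebra n) (delta R) \<longleftrightarrow>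
           unital_subalgebra class_ring L (mat_algebra (n + 1)) \<and>
           split_local class_ring ((mat_algebra (n + 1))\<lparr>carrier := L\<rparr>) \<and>
           jacobson_radical ((mat_algebra (n + 1))\<lparr>carrier := L\<rparr>) = V)"
proof -
  interpret regular_affine_subgroup n R V L
    using assms by (rule regular_affine_subgroup.intro)
  have "nonunital_subring V (mat_algebra N)" if "\<forall>x \<in> V. \<forall>y \<in> V. x + y \<in> V"
    using that by (intro nonunital_subring_V) blast
  moreover have "unital_subalgebra class_ring L (mat_algebra N) \<and>
      split_local class_ring L_algebra \<and> jacobson_radical L_algebra = V"
    if "\<forall>x \<in> V. \<forall>y \<in> V. x + y \<in> V" "\<forall>a. \<forall>x \<in> V. a \<cdot>\<^sub>m x \<in> V"
    using that unital_subalgebra_L split_local_L jacobson_radical_L by metis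
  moreover have "(\<forall>x \<in> V. \<forall>y \<in> V. x + y \<in> V) \<and> (\<forall>a. \<forall>x \<in> V. a \<cdot>\<^sub>m x \<in> V)"
    if "unital_subalgebra class_ring L (mat_algebra N)" "jacobson_radical L_algebra = V"
    using that V_closed_if_jacobson_radical by (simp add: unital_subalgebra_def)
  ultimately show ?thesis
    \<comment> \<open>The facts above concern closure of \<open>V\<close>; these equivalences
      restate the conditions on \<open>delta R\<close> in the same terms.\<close>
    unfolding V_add_iff linear_delta_iff
    using V_nil_block unfolding nil_block_def by blast
qed

end
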